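(* Let $\mathbb{S}_1\subseteq\mathbb{R}^{m\times n}$ and $\mathbb{S}_2\subseteq\mathbb{R}^m$ be linear subspaces of structured matrices and vectors with structure matrices $\Phi_{\mathbb{S}_1}\in\mathbb{R}^{mn\times k_1}$ and $\Phi_{\mathbb{S}_2}\in\mathbb{R}^{m\times k_2}$ (see context), $m\ge n$. Let $A\in\mathbb{S}_1$, $b\in\mathbb{S}_2$, let $J=\mathrm{diag}(I_p,-I_q)$ with $p+q=m$, and assume $M=A^TJA$ is positive definite. Let $x=M^{-1}A^TJb$, $r=b-Ax$, let $L\in\mathbb{R}^{n\times k}$ ($k\le n$) be fixed, and set $$M_{g'}=\left[\left((Jr)^T\otimes(L^TM^{-1})\right)\Pi_{mn}-x^T\otimes(L^TM^{-1}A^TJ),\ \ L^TM^{-1}A^TJ\right].$$ Let $D_i=\mathrm{diag}\left(\|\Phi_{\mathbb{S}_i}(:,1)\|_2,\dots,\|\Phi_{\mathbb{S}_i}(:,k_i)\|_2\right)$ for $i=1,2$. Then, for parameters $\Psi\in\mathbb{S}_1$, $\beta\in\mathbb{S}_2$, $\xi\in\mathbb{R}^k$, the structured partial condition number under the 2-norm of the indefinite least squares problem with respect to $L$ (defined in the context) is $$\kappa^S_{2ILS}(A,b)=\left\|\mathrm{diag}^{\ddag}(\xi)M_{g'}\,\mathrm{diag}(\mathrm{vec}(\Psi,\beta))\begin{bmatrix}\Phi_{\mathbb{S}_1}D_1^{-1}&0\\0&\Phi_{\mathbb{S}_2}D_2^{-1}\end{bmatrix}\right\|_2 .$$ If instead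 the parameters $\Psi,\beta,\xi$ are positive real numbers, then $$\kappa^S_{2ILS}(A,b)=\frac{\left\|\left[\Psi\left(\left((Jr)^T\otimes(L^TM^{-1})\right)\Pi_{mn}-x^T\otimes(L^TM^{-1}A^TJ)\right)\Phi_{\mathbb{S}_1}D_1^{-1},\ \ \beta L^TM^{-1}A^TJ\,\Phi_{\mathbb{S}_2}D_2^{-1}\right]\right\|_2}{\xi}.$$
   Context: The indefinite least squares (ILS) problem is $\min_{x\in\mathbb{R}^n}(b-Ax)^TJ(b-Ax)$; when $A^TJA$ is positive definite its unique solution is $x(A,b)=M^{-1}A^TJb$. Notation: for $c\in\mathbb{R}$, $c^{\ddag}=1/c$ if $c\neq 0$ and $c^{\ddag}=1$ if $c=0$. For a vector $v$, $\mathrm{diag}(v)$ is the diagonal matrix with diagonal $v$, and $\mathrm{diag}^{\ddag}(v)$ the diagonal matrix with diagonal entries $v_i^{\ddag}$. Entry-wise division of vectors is $\frac{a}{v}=\mathrm{diag}^{\ddag}(v)a$, and similarly for matrices of equal size; division by a scalar parameter is ordinary division. $\mathrm{vec}$ stacks the columns of a matrix; $\mathrm{vec}(\Psi,\beta)$ is $\mathrm{vec}(\Psi)$ stacked on top of $\beta$ (same convention for other pairs). $\otimes$ is the Kronecker product; $\Pi_{mn}$ is the vec-permutation matrix with $\Pi_{mn}\mathrm{vec}(X)=\mathrm{vec}(X^T)$ for all $X\in\mathbb{R}^{m\times n}$. $\|\cdot\|_2$ is the spectral norm of a matrix or Euclidean norm of a vector, and $\Phi(:,j)$ is the $j$-th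 column of $\Phi$. Structures: $\mathbb{S}_1$ (e.g. symmetric, Toeplitz or Hankel matrices) and $\mathbb{S}_2$ are described by fixed structure matrices: $X\in\mathbb{S}_1$ iff $\mathrm{vec}(X)=\Phi_{\mathbb{S}_1}s_1$ for some vector $s_1\in\mathbb{R}^{k_1}$ of independent parameters, and $y\in\mathbb{S}_2$ iff $y=\Phi_{\mathbb{S}_2}s_2$ for some vector $s_2\in\mathbb{R}^{k_2}$ of independent parameters. Each structure matrix $\Phi$ has the properties: its columns are nonzero and mutually orthogonal; and $\frac{\Phi s}{\Phi\varphi}=\Phi\frac{s}{\varphi}$ for all $s,\varphi$ such that $s_j=0$ whenever $\varphi_j=0$ (as holds for $0$-$1$ matrices with at most one $1$ in each row and no zero column). Let $g(A,b)=L^Tx(A,b)$, with Fréchet derivative (as a map on all of $\mathbb{R}^{m\times n}\times\mathbb{R}^m$) $$g'(A,b)\circ(\Delta A,\Delta b)=L^TM^{-1}(\Delta A)^TJr-L^TM^{-1}A^TJ(\Delta A)x+L^TM^{-1}A^TJ\,\Delta b .$$ The structured partial condition number under the 2-norm is $$\kappa^S_{2ILS}(A,b)=\sup\frac{\left\|\frac{g'(A,b)\circ(\Delta A,\Delta b)}{\xi}\right\|_2}{\left\|\mathrm{vec}\left(\frac{\Delta A}{\Psi},\frac{\Delta b}{\beta}\right)\right\|_2},$$ the supremum being over $\Delta A\in\mathbb{S}_1$, $\Delta b\in\mathbb{S}_2$ with $\left\|\mathrm{vec}\left(\frac{\Delta A}{\Psi},\frac{\Delta b}{\beta}\right)\right\|_2\ne0$,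 with the requirement that if some entry of $\Psi$ or $\beta$ is zero, the corresponding entry of $\Delta A$ or $\Delta b$ is zero. Here either $\Psi\in\mathbb{S}_1,\beta\in\mathbb{S}_2,\xi\in\mathbb{R}^k$, or $\Psi,\beta,\xi$ are positive real numbers. *)

theory Defs
  imports "HOL-Analysis.Analysis"
begin

definition ddag :: "real \<Rightarrow> real" where
  "ddag c = (if c = 0 then 1 else 1 / c)"

definition diag_mat :: "real^'a \<Rightarrow> real^'a^'a" where
  "diag_mat v = (\<chi> i j. if i = j then v $ i else 0)"

definition diag_ddag :: "real^'a \<Rightarrow> real^'a^'a" where
  "diag_ddag v = diag_mat (\<chi> i. ddag (v $ i))"

definition vec_div :: "real^'a::finite \<Rightarrow> real^'a \<Rightarrow> real^'a" where
  "vec_div a v = diag_ddag v *v a"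

definition mat_div :: "real^'n^'m \<Rightarrow> real^'n^'m \<Rightarrow> real^'n^'m" where
  "mat_div X Y = (\<chi> i j. ddag (Y $ i $ j) * X $ i $ j)"

text \<open>
  The entry in row \<open>i\<close> and column \<open>j\<close> of an \<open>m \<times> n\<close> matrix is stored at index \<open>(j, i)\<close>; in the
  lexicographic order this stacks the columns. Rows and columns of a Kronecker product are likewise
  indexed by pairs whose first component selects the block. Stacking uses sum types as index types.
\<close>

definition vec_of :: "real^'n^'m \<Rightarrow> real^('n \<times> 'm)" where
  "vec_of X = (\<chi> ji. X $ snd ji $ fst ji)"

definition vec_append :: "real^'a \<Rightarrow> real^'b \<Rightarrow> real^('a + 'b)" where
  "vec_append u v = (\<chi> i. case i of Inl a \<Rightarrow> u $ a | Inr b \<Rightarrow> v $ b)"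

definition vec_pair :: "real^'n^'m \<Rightarrow> real^'m \<Rightarrow> real^(('n \<times> 'm) + 'm)" where
  "vec_pair X y = vec_append (vec_of X) y"

definition kron :: "real^'b^'a \<Rightarrow> real^'d^'c \<Rightarrow> real^('b \<times> 'd)^('a \<times> 'c)" where
  "kron X Y = (\<chi> ac bd. X $ fst ac $ fst bd * Y $ snd ac $ snd bd)"

text \<open>\<open>v\<^sup>T \<otimes> B\<close>, with the row index type \<open>1 \<times> 'k\<close> identified with \<open>'k\<close>.\<close>

definition row_kron :: "real^'a \<Rightarrow> real^'d^'k \<Rightarrow> real^('a \<times> 'd)^'k" where
  "row_kron v B = (\<chi> i. kron (rowvector v :: real^'a^1) B $ (1, i))"

definition vec_perm :: "real^('n::finite \<times> 'm::finite)^('m \<times> 'n)" where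
  "vec_perm = (\<chi> ij ji. if ji = prod.swap ij then 1 else 0)"

definition hcat :: "real^'a^'k \<Rightarrow> real^'b^'k \<Rightarrow> real^('a + 'b)^'k" where
  "hcat X Y = (\<chi> i. vec_append (X $ i) (Y $ i))"

definition block_diag :: "real^'b^'a \<Rightarrow> real^'d^'c \<Rightarrow> real^('b + 'd)^('a + 'c)" where
  "block_diag X Y =
     (\<chi> i. case i of Inl a \<Rightarrow> vec_append (X $ a) 0 | Inr c \<Rightarrow> vec_append 0 (Y $ c))"

lemma vec_perm_mult_vec_of:
  fixes X :: "real^'n::finite^'m::finite"
  shows "vec_perm *v vec_of X = vec_of (transpose X)"
proof (rule vec_eq_iff[THEN iffD2], rule allI)
  fix ij :: "'m \<times> 'n"
  have "(vec_perm *v vec_of X) $ ij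
      = (\<Sum>ji\<in>UNIV. (if ji = prod.swap ij then vec_of X $ ji else 0))"
    by (simp add: matrix_vector_mult_def vec_perm_def if_distrib[of "\<lambda>c. c * _"] cong: if_cong)
  then show "(vec_perm *v vec_of X) $ ij = vec_of (transpose X) $ ij"
    by (simp add: vec_of_def transpose_def)
qed

lemma vec_perm_unique:
  fixes P :: "real^('n::finite \<times> 'm::finite)^('m \<times> 'n)"
  assumes "\<And>X :: real^'n^'m. P *v vec_of X = vec_of (transpose X)"
  shows "P = vec_perm"
proof -
  have "P *v v = vec_perm *v v" for v :: "real^('n \<times> 'm)"
  proof -
    have "v = vec_of (\<chi> i j. v $ (j, i))"
      by (simp add: vec_of_def vec_eq_iff)
    then show ?thesis
      using assms vec_perm_mult_vec_of by metis
  qed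
  then show ?thesis
    by (simp add: matrix_eq)
qed

text \<open>The matrix type carries the Frobenius norm, so the spectral norm is introduced separately.\<close>

definition spectral_norm :: "real^'b::finite^'a::finite \<Rightarrow> real" where
  "spectral_norm X = onorm ((*v) X)"

definition pos_def :: "real^'n::finite^'n \<Rightarrow> bool" where
  "pos_def X \<longleftrightarrow> transpose X = X \<and> (\<forall>v. v \<noteq> 0 \<longrightarrow> 0 < v \<bullet> (X *v v))"

definition structure_matrix :: "real^'k::finite^'a::finite \<Rightarrow> bool" where
  "structure_matrix \<Phi> \<longleftrightarrow>
     (\<forall>j. column j \<Phi> \<noteq> 0) \<and>
     (\<forall>i j. i \<noteq> j \<longrightarrow> column i \<Phi> \<bullet> column j \<Phi> = 0) \<and>
     (\<forall>s \<phi>. (\<forall>j. \<phi> $ j = 0 \<longrightarrow> s $ j = 0) \<longrightarrow>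
        vec_div (\<Phi> *v s) (\<Phi> *v \<phi>) = \<Phi> *v vec_div s \<phi>)"

definition col_norms :: "real^'k^'a::finite \<Rightarrow> real^'k^'k" where
  "col_norms \<Phi> = diag_mat (\<chi> j. norm (column j \<Phi>))"

text \<open>\<open>diag(I\<^sub>p, -I\<^sub>q)\<close>: the first \<open>p\<close> indices in the order of the index type get the entry \<open>1\<close>,
  the remaining ones \<open>-1\<close>.\<close>

definition signature_mat :: "nat \<Rightarrow> real^'m::{finite,linorder}^'m::{finite,linorder}" where
  "signature_mat p = diag_mat (\<chi> i. if card {j. j < i} < p then 1 else - 1)"

definition ils_solution ::
    "real^'m::finite^'m \<Rightarrow> real^'n::finite^'m \<Rightarrow> real^'m \<Rightarrow> real^'n" where
  "ils_solution J A b = matrix_inv (transpose A ** J ** A) *v (transpose A *v (J *v b))"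

definition ils_g ::
    "real^'m::finite^'m \<Rightarrow> real^'k::finite^'n::finite \<Rightarrow> (real^'n^'m) \<times> (real^'m) \<Rightarrow> real^'k" where
  "ils_g J L = (\<lambda>(A, b). transpose L *v ils_solution J A b)"

text \<open>
  The supremum is taken in \<^typ>\<open>ennreal\<close>: it is then not presupposed to be finite, and it is
  \<open>0\<close> when there is no admissible perturbation (\<open>\<Psi> = 0\<close>, \<open>\<beta> = 0\<close>).
\<close>

definition kappa_2ILS ::
    "(real^'n::finite^'m::finite) set \<Rightarrow> (real^'m) set \<Rightarrow> real^'m^'m \<Rightarrow> real^'k::finite^'n
      \<Rightarrow> real^'n^'m \<Rightarrow> real^'m \<Rightarrow> real^'k \<Rightarrow> real^'n^'m \<Rightarrow> real^'m \<Rightarrow> ennreal" where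
  "kappa_2ILS S1 S2 J L \<Psi> \<beta> \<xi> A b =
     (SUP (dA, db) \<in> {(dA, db). dA \<in> S1 \<and> db \<in> S2 \<and>
          norm (vec_pair (mat_div dA \<Psi>) (vec_div db \<beta>)) \<noteq> 0 \<and>
          (\<forall>i j. \<Psi> $ i $ j = 0 \<longrightarrow> dA $ i $ j = 0) \<and>
          (\<forall>i. \<beta> $ i = 0 \<longrightarrow> db $ i = 0)}.
        ennreal (norm (vec_div (frechet_derivative (ils_g J L) (at (A, b)) (dA, db)) \<xi>)
                 / norm (vec_pair (mat_div dA \<Psi>) (vec_div db \<beta>))))"

definition kappa_2ILS_scalar ::
    "(real^'n::finite^'m::finite) set \<Rightarrow> (real^'m) set \<Rightarrow> real^'m^'m \<Rightarrow> real^'k::finite^'n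
      \<Rightarrow> real \<Rightarrow> real \<Rightarrow> real \<Rightarrow> real^'n^'m \<Rightarrow> real^'m \<Rightarrow> ennreal" where
  "kappa_2ILS_scalar S1 S2 J L \<Psi> \<beta> \<xi> A b =
     (SUP (dA, db) \<in> {(dA, db). dA \<in> S1 \<and> db \<in> S2 \<and>
          norm (vec_pair (dA /\<^sub>R \<Psi>) (db /\<^sub>R \<beta>)) \<noteq> 0}.
        ennreal (norm (frechet_derivative (ils_g J L) (at (A, b)) (dA, db) /\<^sub>R \<xi>)
                 / norm (vec_pair (dA /\<^sub>R \<Psi>) (db /\<^sub>R \<beta>))))"

end

theory Submission imports Defs begin

text \<open>
  Testing the division identity on unit vectors shows that a structure matrix is a \<open>0\<close>-\<open>1\<close> matrix with
  at most one \<open>1\<close> in each row. Hence \<open>\<Phi>\<close> commutes with entrywise products, and since its columns are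
  orthogonal, \<open>\<Phi> D\<^sup>-\<^sup>1\<close> is an isometry. The admissible perturbations are therefore exactly the vectors
  \<open>diag(z) \<Phi> D\<^sup>-\<^sup>1 u\<close> with \<open>z\<close> the parameter, and for \<open>u\<close> without superfluous coordinates the norm of
  the perturbation divided by \<open>z\<close> is the norm of \<open>u\<close>. The condition number thus becomes the supremum
  of \<open>\<parallel>B u\<parallel> / \<parallel>u\<parallel>\<close> for the matrix \<open>B\<close> of the claim.
\<close>

section \<open>Diagonal matrices, entrywise division and matrix inverses\<close>

lemma diag_mat_mult_nth: "(diag_mat v *v y) $ i = v $ i * y $ i"
proof -
  have "(diag_mat v *v y) $ i = (\<Sum>j\<in>UNIV. if i = j then v $ i * y $ j else 0)"
    unfolding matrix_vector_mult_def diag_mat_def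
    by (simp add: if_distrib[of "\<lambda>c. c * _"] cong: if_cong)
  then show ?thesis
    by simp
qed

lemma vec_div_nth: "vec_div a v $ i = ddag (v $ i) * a $ i"
  by (simp add: vec_div_def diag_ddag_def diag_mat_mult_nth)

lemma ddag_nonzero: "ddag c \<noteq> 0"
  by (simp add: ddag_def)

lemma vec_div_eq_0_iff: "vec_div a v = 0 \<longleftrightarrow> a = 0"
  by (simp add: vec_eq_iff vec_div_nth ddag_nonzero)

lemma matrix_inv_inverses:
  assumes "invertible X"
  shows "X ** matrix_inv X = mat 1" and "matrix_inv X ** X = mat 1"
  using someI_ex[OF assms[unfolded invertible_def]] by (simp_all add: matrix_inv_def)

lemma invertible_diag_mat:
  assumes "\<And>i. v $ i \<noteq> 0"
  shows "invertible (diag_mat v)"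
proof -
  have "diag_mat (\<chi> i. inverse (v $ i)) ** diag_mat v = mat 1"
    using assms
    by (simp add: matrix_eq vec_eq_iff diag_mat_mult_nth flip: matrix_vector_mul_assoc)
  then show ?thesis
    unfolding invertible_left_inverse by blast
qed

lemma pos_def_invertible:
  assumes "pos_def X"
  shows "invertible X"
  unfolding invertible_left_inverse matrix_left_invertible_ker
  using assms unfolding pos_def_def by (metis inner_zero_right less_irrefl)

subsection \<open>Stacked vectors and block matrices\<close>

lemma vec_of_surj: "\<exists>X. vec_of X = v"
  by (rule exI[of _ "\<chi> i j. v $ (j, i)"]) (simp add: vec_of_def vec_eq_iff)

lemma vec_of_nth: "vec_of X $ (j, i) = X $ i $ j"
  by (simp add: vec_of_def)

lemma vec_of_scaleR: "vec_of (c *\<^sub>R X) = c *\<^sub>R vec_of X"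
  by (simp add: vec_of_def vec_eq_iff)

lemma vec_of_mat_div: "vec_of (mat_div X Y) = vec_div (vec_of X) (vec_of Y)"
  by (simp add: vec_of_def mat_div_def vec_eq_iff vec_div_nth)

lemma vec_append_nth [simp]:
  "vec_append u v $ Inl a = u $ a" "vec_append u v $ Inr b = v $ b"
  by (simp_all add: vec_append_def)

lemma vec_eq_iff_sum: "u = v \<longleftrightarrow> (\<forall>a. u $ Inl a = v $ Inl a) \<and> (\<forall>b. u $ Inr b = v $ Inr b)"
  unfolding vec_eq_iff by (metis obj_sumE)

lemma vec_append_surj: "\<exists>u v. w = vec_append u v"
  by (rule exI[of _ "\<chi> a. w $ Inl a"], rule exI[of _ "\<chi> b. w $ Inr b"]) (simp add: vec_eq_iff_sum)

lemma vec_append_eq_0_iff: "vec_append u v = 0 \<longleftrightarrow> u = 0 \<and> v = 0"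
  by (simp add: vec_eq_iff_sum) (simp add: vec_eq_iff)

lemma sum_UNIV_Plus:
  fixes f :: "'a::finite + 'b::finite \<Rightarrow> 'c::comm_monoid_add"
  shows "(\<Sum>i\<in>UNIV. f i) = (\<Sum>a\<in>UNIV. f (Inl a)) + (\<Sum>b\<in>UNIV. f (Inr b))"
  by (simp add: UNIV_Plus_UNIV[symmetric] sum.Plus del: UNIV_Plus_UNIV)

lemma norm_vec_append:
  fixes u :: "real^'a::finite" and v :: "real^'b::finite"
  shows "norm (vec_append u v) = sqrt ((norm u)\<^sup>2 + (norm v)\<^sup>2)"
  by (simp add: norm_eq_sqrt_inner power2_norm_eq_inner inner_vec_def sum_UNIV_Plus sum_nonneg)

lemma hcat_mult_vec_append:
  fixes X :: "real^'a::finite^'k" and Y :: "real^'b::finite^'k"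
  shows "hcat X Y *v vec_append u v = X *v u + Y *v v"
  by (simp add: hcat_def matrix_vector_mult_def vec_eq_iff sum_UNIV_Plus)

lemma block_diag_mult_vec_append:
  fixes X :: "real^'b::finite^'a" and Y :: "real^'d::finite^'c"
  shows "block_diag X Y *v vec_append u v = vec_append (X *v u) (Y *v v)"
  by (simp add: block_diag_def matrix_vector_mult_def vec_eq_iff_sum sum_UNIV_Plus)

lemma diag_mat_vec_append_mult:
  fixes u v :: "real^'a::finite" and w z :: "real^'b::finite"
  shows "diag_mat (vec_append u w) *v vec_append v z
    = vec_append (diag_mat u *v v) (diag_mat w *v z)"
  by (simp add: vec_eq_iff_sum diag_mat_mult_nth)

text \<open>Exchanging the two summations over the pair index gives it. It translates the Kronecker
  blocks of \<open>N\<close> into terms of the Frechet derivative.\<close>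

lemma row_kron_mult_vec_of:
  fixes B :: "real^'d::finite^'k" and X :: "real^'a::finite^'d" and v :: "real^'a"
  shows "row_kron v B *v vec_of X = B *v (X *v v)"
proof -
  have "(row_kron v B *v vec_of X) $ i = (B *v (X *v v)) $ i" for i
  proof -
    have "(row_kron v B *v vec_of X) $ i
        = (\<Sum>ac\<in>UNIV. v $ fst ac * B $ i $ snd ac * X $ snd ac $ fst ac)"
      by (simp add: matrix_vector_mult_def row_kron_def kron_def vec_of_def rowvector_def)
    also have "\<dots> = (\<Sum>a\<in>UNIV. \<Sum>c\<in>UNIV. v $ a * B $ i $ c * X $ c $ a)"
      by (simp add: sum.cartesian_product UNIV_Times_UNIV[symmetric] case_prod_unfold
          del: UNIV_Times_UNIV)
    also have "\<dots> = (\<Sum>c\<in>UNIV. \<Sum>a\<in>UNIV. v $ a * B $ i $ c * X $ c $ a)"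
      by (rule sum.swap)
    finally show ?thesis
      by (simp add: matrix_vector_mult_def sum_distrib_left mult_ac)
  qed
  then show ?thesis
    by (simp add: vec_eq_iff)
qed

subsection \<open>Structure matrices\<close>

lemma structure_matrix_div:
  assumes "structure_matrix \<Phi>" and "\<And>j. \<phi> $ j = 0 \<Longrightarrow> s $ j = 0"
  shows "vec_div (\<Phi> *v s) (\<Phi> *v \<phi>) = \<Phi> *v vec_div s \<phi>"
  using assms by (simp add: structure_matrix_def)

text \<open>A unit vector divided entrywise by itself is itself, so the division property makes
  column \<open>j\<close> equal to its quotient by itself; at a nonzero entry this quotient is
  1.\<close>

lemma structure_matrix_entry_1:
  assumes \<Phi>: "structure_matrix \<Phi>" and "\<Phi> $ i $ j \<noteq> 0"
  shows "\<Phi> $ i $ j = 1"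
proof -
  let ?e = "axis j 1"
  have "vec_div ?e ?e = (?e :: real^_)"
    by (simp add: vec_eq_iff vec_div_nth axis_def ddag_def)
  then have "vec_div (column j \<Phi>) (column j \<Phi>) $ i = column j \<Phi> $ i"
    using structure_matrix_div[OF \<Phi>, of ?e ?e] by (simp add: matrix_vector_mult_basis)
  then show ?thesis
    using assms(2) by (simp add: vec_div_nth column_def ddag_def)
qed

text \<open>Divide the unit vector e_j by e_j + e_l: the parameter quotient is e_j, so entry
  \<open>i\<close> of the image quotient must be 1. Two nonzero entries in row \<open>i\<close>,
  both equal to 1, would make it 1/2.\<close>

lemma structure_matrix_row_unique:
  assumes \<Phi>: "structure_matrix \<Phi>" and "\<Phi> $ i $ j \<noteq> 0" and "\<Phi> $ i $ l \<noteq> 0"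
  shows "j = l"
proof (rule ccontr)
  assume "j \<noteq> l"
  let ?s = "axis j 1" and ?\<phi> = "axis j 1 + axis l 1"
  have "vec_div ?s ?\<phi> = (?s :: real^_)"
    using \<open>j \<noteq> l\<close> by (simp add: vec_eq_iff vec_div_nth axis_def ddag_def)
  moreover have "vec_div (\<Phi> *v ?s) (\<Phi> *v ?\<phi>) = \<Phi> *v vec_div ?s ?\<phi>"
    by (rule structure_matrix_div[OF \<Phi>]) (auto simp: axis_def split: if_splits)
  ultimately have "vec_div (column j \<Phi>) (column j \<Phi> + column l \<Phi>) $ i = column j \<Phi> $ i"
    by (simp add: matrix_vector_mult_basis matrix_vector_right_distrib)
  then show False
    using structure_matrix_entry_1[OF \<Phi> assms(2)] structure_matrix_entry_1[OF \<Phi> assms(3)]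
    by (simp add: vec_div_nth column_def ddag_def)
qed

lemma structure_matrix_mult_nth:
  assumes \<Phi>: "structure_matrix \<Phi>" and ij: "\<Phi> $ i $ j \<noteq> 0"
  shows "(\<Phi> *v s) $ i = s $ j"
proof -
  have "\<Phi> $ i $ l = (if l = j then 1 else 0)" for l
    using structure_matrix_entry_1[OF \<Phi> ij] structure_matrix_row_unique[OF \<Phi> ij] by auto
  then have "(\<Phi> *v s) $ i = (\<Sum>l\<in>UNIV. if l = j then s $ l else 0)"
    by (simp add: matrix_vector_mult_def if_distrib[of "\<lambda>c. c * _"] cong: if_cong)
  then show ?thesis
    by simp
qed

lemma structure_matrix_column_entry:
  assumes "structure_matrix \<Phi>"
  obtains i where "\<Phi> $ i $ j \<noteq> 0"
  using assms unfolding structure_matrix_def by (force simp: vec_eq_iff column_def)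

text \<open>Every row of \<Phi> is zero or a unit vector, so each entry of the image is 0 or a copy
  of one coordinate, and copying commutes with entrywise products.\<close>

lemma structure_matrix_mult_diag:
  assumes \<Phi>: "structure_matrix \<Phi>"
  shows "\<Phi> *v (diag_mat \<phi> *v w) = diag_mat (\<Phi> *v \<phi>) *v (\<Phi> *v w)"
proof -
  have "(\<Phi> *v (diag_mat \<phi> *v w)) $ i = (\<Phi> *v \<phi>) $ i * (\<Phi> *v w) $ i" for i
  proof (cases "\<exists>j. \<Phi> $ i $ j \<noteq> 0")
    case True
    then show ?thesis
      using structure_matrix_mult_nth[OF \<Phi>] by (metis diag_mat_mult_nth)
  next
    case False
    then show ?thesis
      by (simp add: matrix_vector_mult_def)
  qed
  then show ?thesis
    by (simp add: vec_eq_iff diag_mat_mult_nth)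
qed

text \<open>No column is zero, so coordinate \<open>j\<close> reappears as an entry of the image, at
  the same place for \<open>s\<close> and for \<phi>. This carries the condition on zeros from
  perturbations back to parameters.\<close>

lemma structure_matrix_zero_pattern:
  assumes \<Phi>: "structure_matrix \<Phi>"
    and "\<And>i. (\<Phi> *v \<phi>) $ i = 0 \<Longrightarrow> (\<Phi> *v s) $ i = 0" and "\<phi> $ j = 0"
  shows "s $ j = 0"
  using structure_matrix_column_entry[OF \<Phi>, of j] structure_matrix_mult_nth[OF \<Phi>] assms(2,3)
  by metis

text \<open>By Pythagoras, since \<open>\<Phi> *v s\<close> is a sum of multiples of mutually
  orthogonal columns.\<close>

lemma norm_structure_matrix_mult:
  assumes "structure_matrix \<Phi>"
  shows "norm (\<Phi> *v s) = norm (col_norms \<Phi> *v s)"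
proof -
  have "(norm (\<Phi> *v s))\<^sup>2 = (\<Sum>j\<in>UNIV. (norm (s $ j *\<^sub>R column j \<Phi>))\<^sup>2)"
    unfolding matrix_mult_sum scalar_mult_eq_scaleR using assms
    by (intro norm_sum_Pythagorean)
      (auto simp: pairwise_def orthogonal_def structure_matrix_def)
  also have "\<dots> = (norm (col_norms \<Phi> *v s))\<^sup>2"
    unfolding power2_norm_eq_inner[of "col_norms \<Phi> *v s"] inner_vec_def
    by (simp add: col_norms_def diag_mat_mult_nth power_mult_distrib mult.commute flip: power2_eq_square)
  finally show ?thesis
    by simp
qed

lemma invertible_col_norms:
  assumes "structure_matrix \<Phi>"
  shows "invertible (col_norms \<Phi>)"
  using assms unfolding col_norms_def structure_matrix_def by (intro invertible_diag_mat) simp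

section \<open>Structure matrices with normalised columns\<close>

definition normalize_columns :: "real^'k::finite^'a::finite \<Rightarrow> real^'k^'a" where
  "normalize_columns \<Phi> = \<Phi> ** matrix_inv (col_norms \<Phi>)"

lemma norm_normalize_columns_mult:
  assumes "structure_matrix \<Phi>"
  shows "norm (normalize_columns \<Phi> *v u) = norm u"
proof -
  have "norm (normalize_columns \<Phi> *v u)
      = norm (col_norms \<Phi> *v (matrix_inv (col_norms \<Phi>) *v u))"
    using norm_structure_matrix_mult[OF assms]
    by (simp add: normalize_columns_def flip: matrix_vector_mul_assoc)
  then show ?thesis
    by (simp add: matrix_vector_mul_assoc matrix_inv_inverses invertible_col_norms[OF assms])
qed

lemma normalize_columns_mult_col_norms:
  assumes "structure_matrix \<Phi>"
  shows "normalize_columns \<Phi> *v (col_norms \<Phi> *v s) = \<Phi> *v s"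
  by (simp add: normalize_columns_def matrix_vector_mul_assoc flip: matrix_mul_assoc)
    (simp add: matrix_inv_inverses invertible_col_norms[OF assms])

text \<open>Serves the upper bound on the condition number: each admissible perturbation comes from
  some \<open>u\<close> with exactly the right norm. The hypothesis on zeros is what makes the
  division property applicable.\<close>

lemma admissible_as_scaled_parameter:
  assumes \<Phi>: "structure_matrix \<Phi>"
    and y: "y = \<Phi> *v s" and z: "z = \<Phi> *v \<phi>" and zero: "\<And>i. z $ i = 0 \<Longrightarrow> y $ i = 0"
  shows "\<exists>u. y = diag_mat z *v (normalize_columns \<Phi> *v u) \<and> norm (vec_div y z) = norm u"
proof -
  \<comment> \<open>Scaling by the column norms cancels the normalisation, leaving \<Phi> applied to
    the entrywise quotient of \<open>s\<close> by \<phi>.\<close>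
  define u where "u = col_norms \<Phi> *v vec_div s \<phi>"
  have s0: "s $ j = 0" if "\<phi> $ j = 0" for j
    using structure_matrix_zero_pattern[OF \<Phi>] zero that y z by metis
  have C: "normalize_columns \<Phi> *v u = \<Phi> *v vec_div s \<phi>"
    by (simp add: u_def normalize_columns_mult_col_norms \<Phi>)
  \<comment> \<open>Where \<phi> vanishes, multiplying back gives 0, which is the entry of
    \<open>s\<close> there by \<open>s0\<close>.\<close>
  have "diag_mat \<phi> *v vec_div s \<phi> = s"
    using s0 by (auto simp: vec_eq_iff diag_mat_mult_nth vec_div_nth ddag_def)
  then have "y = diag_mat z *v (normalize_columns \<Phi> *v u)"
    using structure_matrix_mult_diag[OF \<Phi>, of \<phi> "vec_div s \<phi>"] by (simp add: y z C)
  moreover have "vec_div y z = normalize_columns \<Phi> *v u"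
    using structure_matrix_div[OF \<Phi> s0] by (simp add: y z C)
  ultimately show ?thesis
    using norm_normalize_columns_mult[OF \<Phi>] by metis
qed

text \<open>Coordinates of the parameter on which \<open>z\<close> vanishes do not affect the product and are dropped
  from \<open>u\<close>; this is why the last norm is only bounded.\<close>

lemma scaled_parameter_as_admissible:
  assumes \<Phi>: "structure_matrix \<Phi>" and z: "z = \<Phi> *v \<phi>"
  shows "\<exists>s. \<Phi> *v s = diag_mat z *v (normalize_columns \<Phi> *v u) \<and>
    norm (vec_div (\<Phi> *v s) z) \<le> norm u"
proof -
  define w where "w = matrix_inv (col_norms \<Phi>) *v u"
  define s where "s = diag_mat \<phi> *v w"
  have C: "normalize_columns \<Phi> *v u = \<Phi> *v w"
    by (simp add: normalize_columns_def w_def matrix_vector_mul_assoc)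
  have s: "\<Phi> *v s = diag_mat z *v (normalize_columns \<Phi> *v u)"
    by (simp add: s_def structure_matrix_mult_diag[OF \<Phi>] z C)
  \<comment> \<open>Where \<open>z\<close> vanishes, the dividend is already 0 and
    \<open>ddag 0 = 1\<close> leaves it so; elsewhere the factor \<open>z\<close> cancels.\<close>
  have "vec_div (\<Phi> *v s) z $ i
      = (if z $ i = 0 then 0 else (normalize_columns \<Phi> *v u) $ i)" for i
    by (simp add: s vec_div_nth diag_mat_mult_nth ddag_def)
  then have "norm (vec_div (\<Phi> *v s) z) \<le> norm (normalize_columns \<Phi> *v u)"
    by (intro norm_le_componentwise_cart) simp
  then show ?thesis
    using s norm_normalize_columns_mult[OF \<Phi>] by metis
qed

subsection \<open>The Frechet derivative of the solution\<close>

lemma matrix_vector_mult_bounded_bilinear: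
  "bounded_bilinear (\<lambda>(X :: real^'n::finite^'m::finite) v. X *v v)"
  unfolding bilinear_conv_bounded_bilinear[symmetric] bilinear_def
  by (auto intro!: linearI simp: algebra_simps scaleR_matrix_vector_assoc)

lemma bounded_linear_transpose:
  "bounded_linear (transpose :: real^'n::finite^'m::finite \<Rightarrow> real^'m^'n)"
  unfolding linear_conv_bounded_linear[symmetric]
  by (intro linearI) (simp_all add: transpose_def vec_eq_iff)

section \<open>Differentiability of the solution by Cramer's rule\<close>

lemma differentiable_vec_lambda:
  fixes f :: "'a::real_normed_vector \<Rightarrow> 'n::finite \<Rightarrow> real"
  assumes "\<And>k. (\<lambda>z. f z k) differentiable (at z)"
  shows "(\<lambda>z. \<chi> k. f z k) differentiable (at z)"
proof -
  have "(\<lambda>z. \<chi> k. f z k) = (\<lambda>z. \<Sum>k\<in>UNIV. f z k *\<^sub>R axis k 1)"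
    using basis_expansion[of "\<chi> k. f _ k"] by (simp add: scalar_mult_eq_scaleR)
  then show ?thesis
    using assms by simp
qed

lemma differentiable_prod:
  fixes f :: "'i \<Rightarrow> 'a::real_normed_vector \<Rightarrow> real"
  assumes "\<And>i. i \<in> I \<Longrightarrow> f i differentiable (at z)"
  shows "(\<lambda>z. \<Prod>i\<in>I. f i z) differentiable (at z)"
proof -
  have "\<exists>f'. \<forall>i\<in>I. (f i has_derivative f' i) (at z)"
    using assms unfolding differentiable_def by (intro bchoice) blast
  then show ?thesis
    unfolding differentiable_def by (blast intro: has_derivative_prod)
qed

lemma differentiable_det:
  fixes F :: "'a::real_normed_vector \<Rightarrow> real^'n::finite^'n"
  assumes "\<And>i j. (\<lambda>z. F z $ i $ j) differentiable (at z)"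
  shows "(\<lambda>z. det (F z)) differentiable (at z)"
  unfolding det_def
  by (intro differentiable_sum ballI differentiable_mult differentiable_prod assms
      finite_permutations differentiable_const finite)

text \<open>Replaces the inverse by quotients of determinants, whose differentiability reduces to
  that of the entries.\<close>

lemma matrix_inv_cramer:
  fixes X :: "real^'n::finite^'n"
  assumes "det X \<noteq> 0"
  shows "matrix_inv X *v c = (\<chi> k. det (\<chi> i j. if j = k then c $ i else X $ i $ j) / det X)"
proof -
  have "X *v (matrix_inv X *v c) = c"
    using assms by (simp add: matrix_vector_mul_assoc matrix_inv_inverses invertible_det_nz)
  then show ?thesis
    using cramer[OF assms] by blast
qed

text \<open>The determinant is polynomial in the entries, hence continuous. The set serves as the
  neighbourhood on which the solution is well behaved.\<close>

lemma open_det_nonzero: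
  fixes J :: "real^'m::finite^'m"
  shows "open {z :: (real^'n::finite^'m) \<times> (real^'m). det (transpose (fst z) ** J ** fst z) \<noteq> 0}"
proof -
  have "continuous_on UNIV
      (\<lambda>z :: (real^'n^'m) \<times> (real^'m). det (transpose (fst z) ** J ** fst z))"
    unfolding det_def matrix_matrix_mult_def transpose_def
    by (simp, intro continuous_intros)
  then show ?thesis
    by (intro open_Collect_neq) auto
qed

lemma ils_solution_differentiable:
  fixes A :: "real^'n::finite^'m::finite"
  assumes det: "det (transpose A ** J ** A) \<noteq> 0"
  shows "(\<lambda>(A, b). ils_solution J A b) differentiable (at (A, b))"
proof -
  define F where "F = (\<lambda>z :: (real^'n^'m) \<times> (real^'m). transpose (fst z) ** J ** fst z)"
  define c where "c = (\<lambda>z :: (real^'n^'m) \<times> (real^'m). transpose (fst z) *v (J *v snd z))"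
  \<comment> \<open>\<open>h\<close> is Cramer's formula for the normal equations; it agrees with
    \<open>ils_solution\<close> wherever the determinant is nonzero, which suffices for a derivative
    at the point.\<close>
  define h where
    "h = (\<lambda>z. \<chi> k. det (\<chi> i j. if j = k then c z $ i else F z $ i $ j) / det (F z))"
  have A: "(\<lambda>z. fst z $ i $ j) differentiable (at z0)" for i j and z0 :: "(real^'n^'m) \<times> (real^'m)"
    by (intro bounded_linear_imp_differentiable bounded_linear_compose[OF bounded_linear_vec_nth]
        bounded_linear_fst)
  have b: "(\<lambda>z. snd z $ i) differentiable (at z0)" for i and z0 :: "(real^'n^'m) \<times> (real^'m)"
    by (intro bounded_linear_imp_differentiable bounded_linear_compose[OF bounded_linear_vec_nth]
        bounded_linear_snd)
  have F: "(\<lambda>z. F z $ i $ j) differentiable (at z0)" for i j z0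
    by (simp add: F_def matrix_matrix_mult_def transpose_def A)
  have c: "(\<lambda>z. c z $ i) differentiable (at z0)" for i z0
    by (simp add: c_def matrix_vector_mult_def transpose_def A b)
  have detF: "(\<lambda>z. det (F z)) differentiable (at z0)" for z0
    by (intro differentiable_det F)
  have "h differentiable (at (A, b))"
    unfolding h_def
  proof (intro differentiable_vec_lambda differentiable_divide detF differentiable_det)
    show "(\<lambda>z. (\<chi> i j. if j = k then c z $ i else F z $ i $ j) $ i $ j)
        differentiable (at (A, b))" for k i j
      by (cases "j = k") (simp_all add: F c)
    show "det (F (A, b)) \<noteq> 0"
      using det by (simp add: F_def)
  qed
  then obtain D where D: "(h has_derivative D) (at (A, b))"
    unfolding differentiable_def by blast
  have "open {z. det (F z) \<noteq> 0}"
    unfolding F_def by (rule open_det_nonzero)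
  moreover have "h z = (case z of (A, b) \<Rightarrow> ils_solution J A b)" if "det (F z) \<noteq> 0" for z
    using matrix_inv_cramer[OF that] unfolding h_def ils_solution_def F_def c_def case_prod_unfold
    by (simp del: transpose_matrix_vector)
  ultimately have "((\<lambda>(A, b). ils_solution J A b) has_derivative D) (at (A, b))"
    using det by (intro has_derivative_transform_within_open[OF D]) (auto simp: F_def)
  then show ?thesis
    unfolding differentiable_def by blast
qed

text \<open>Given differentiability, the derivative is read off by differentiating the normal equations
  \<open>A\<^sup>T J (A x - b) = 0\<close>, which hold identically near \<open>(A, b)\<close>.\<close>

lemma ils_solution_has_derivative:
  fixes A :: "real^'n::finite^'m::finite" and b :: "real^'m"
  assumes inv: "invertible (transpose A ** J ** A)"
  defines "M \<equiv> transpose A ** J ** A" and "x \<equiv> ils_solution J A b"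
  defines "r \<equiv> b - A *v x"
  shows "((\<lambda>(A, b). ils_solution J A b) has_derivative
    (\<lambda>(dA, db). matrix_inv M *v (transpose dA *v (J *v r)
       - transpose A *v (J *v (dA *v x)) + transpose A *v (J *v db)))) (at (A, b))"
proof -
  interpret mv_m: bounded_bilinear "\<lambda>(X :: real^'n^'m) v. X *v v"
    by (rule matrix_vector_mult_bounded_bilinear)
  interpret mv_n: bounded_bilinear "\<lambda>(X :: real^'m^'n) v. X *v v"
    by (rule matrix_vector_mult_bounded_bilinear)
  let ?f = "\<lambda>z :: (real^'n^'m) \<times> (real^'m). ils_solution J (fst z) (snd z)"
  \<comment> \<open>\<open>?E\<close> is the defect of the normal equations. Its derivative at the
    point is computed twice: by the product rule in terms of \<open>D\<close>, and as zero because
    \<open>?E\<close> vanishes nearby.\<close>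
  let ?E = "\<lambda>z. transpose (fst z) *v (J *v (fst z *v ?f z - snd z))"
  have det: "det (transpose A ** J ** A) \<noteq> 0"
    using inv invertible_det_nz by blast
  obtain D where D: "(?f has_derivative D) (at (A, b))"
    using ils_solution_differentiable[OF det, of b]
    unfolding differentiable_def case_prod_unfold by blast
  have "(?E has_derivative (\<lambda>h. transpose A *v (J *v ((A *v D h + fst h *v x) - snd h))
      + transpose (fst h) *v (J *v (A *v x - b)))) (at (A, b))"
    using mv_n.FDERIV[OF
        bounded_linear.has_derivative[OF bounded_linear_transpose has_derivative_fst[OF has_derivative_ident]]
        bounded_linear.has_derivative[OF matrix_vector_mul_bounded_linear[of J]
          has_derivative_diff[OF mv_m.FDERIV[OF has_derivative_fst[OF has_derivative_ident] D]
            has_derivative_snd[OF has_derivative_ident]]]]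
    by (simp add: x_def)
  moreover have "(?E has_derivative (\<lambda>h. 0)) (at (A, b))"
  proof (rule has_derivative_transform_within_open[OF has_derivative_const])
    let ?S = "{z :: (real^'n^'m) \<times> (real^'m). det (transpose (fst z) ** J ** fst z) \<noteq> 0}"
    show "open ?S"
      by (rule open_det_nonzero)
    show "(A, b) \<in> ?S"
      using det by simp
    show "0 = ?E z" if "z \<in> ?S" for z
    proof -
      let ?M = "transpose (fst z) ** J ** fst z"
      have "?M *v ?f z = transpose (fst z) *v (J *v snd z)"
        using that unfolding ils_solution_def
        by (simp add: matrix_vector_mul_assoc[of ?M] matrix_inv_inverses invertible_det_nz
            del: matrix_mul_assoc)
      then show ?thesis
        by (simp add: matrix_vector_mult_diff_distrib matrix_vector_mul_assoc matrix_mul_assoc)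
    qed
  qed
  ultimately have eq: "transpose A *v (J *v ((A *v D h + fst h *v x) - snd h))
      + transpose (fst h) *v (J *v (A *v x - b)) = 0" for h
    by (rule has_derivative_unique[THEN fun_cong])
  have "D h = matrix_inv M *v (transpose (fst h) *v (J *v r)
      - transpose A *v (J *v (fst h *v x)) + transpose A *v (J *v snd h))" for h
  proof -
    \<comment> \<open>Collects the terms of \<open>eq\<close> that contain \<open>D h\<close>; the
      others are moved across using that \<open>A *v x - b\<close> is \<open>- r\<close>.\<close>
    have "M *v D h = transpose A *v (J *v (A *v D h))"
      by (simp add: M_def matrix_vector_mul_assoc matrix_mul_assoc)
    then have "M *v D h = transpose (fst h) *v (J *v r)
        - transpose A *v (J *v (fst h *v x)) + transpose A *v (J *v snd h)"
      using eq[of h] by (simp add: r_def algebra_simps)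
    moreover have "matrix_inv M *v (M *v D h) = D h"
      using inv by (simp add: M_def matrix_vector_mul_assoc[of "matrix_inv _"] matrix_inv_inverses)
    ultimately show ?thesis
      by simp
  qed
  then show ?thesis
    using D unfolding case_prod_unfold by presburger
qed

subsection \<open>Suprema of quotients of norms\<close>

text \<open>Each value must be a quotient of \<open>B\<close>, whereas a quotient of
  \<open>B\<close> need only be dominated by some value. Asking this only for
  \<open>B *v u \<noteq> 0\<close> also covers an empty \<open>P\<close>: then \<open>B\<close> is
  zero and so are both sides.\<close>

lemma SUP_eq_spectral_norm:
  fixes B :: "real^'b::finite^'a::finite"
  assumes le: "\<And>p. p \<in> P \<Longrightarrow> \<exists>u. f p = norm (B *v u) / norm u"
    and ge: "\<And>u. B *v u \<noteq> 0 \<Longrightarrow> \<exists>p\<in>P. norm (B *v u) / norm u \<le> f p"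
  shows "(SUP p\<in>P. ennreal (f p)) = ennreal (spectral_norm B)"
proof (rule antisym)
  show "(SUP p\<in>P. ennreal (f p)) \<le> ennreal (spectral_norm B)"
  proof (rule SUP_least)
    fix p
    assume "p \<in> P"
    then obtain u where "f p = norm (B *v u) / norm u"
      using le by blast
    then show "ennreal (f p) \<le> ennreal (spectral_norm B)"
      unfolding spectral_norm_def by (simp add: le_onorm ennreal_leI)
  qed
  show "ennreal (spectral_norm B) \<le> (SUP p\<in>P. ennreal (f p))" (is "_ \<le> ?S")
  \<comment> \<open>An infinite supremum bounds anything; a finite one is turned into a real bound
    for the operator norm.\<close>
  proof (cases "?S = top")
    case False
    have "norm (B *v u) \<le> enn2real ?S * norm u" for u
    proof (cases "B *v u = 0")
      case nz: False
      then obtain p where p: "p \<in> P" "norm (B *v u) / norm u \<le> f p"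
        using ge by blast
      have "ennreal (f p) \<le> ?S"
        using p(1) by (rule SUP_upper)
      then have "norm (B *v u) / norm u \<le> enn2real ?S"
        using p(2) False
        by (metis divide_nonneg_nonneg enn2real_ennreal enn2real_mono norm_ge_zero order_trans
            top.not_eq_extremum)
      moreover have "0 < norm u"
        using nz by auto
      ultimately show ?thesis
        by (simp add: pos_divide_le_eq)
    qed simp
    then have "spectral_norm B \<le> enn2real ?S"
      unfolding spectral_norm_def by (intro onorm_bound) simp_all
    then show ?thesis
      using False by (metis ennreal_enn2real_if ennreal_leI)
  qed (simp only: top_greatest)
qed

section \<open>The two formulas for the condition number\<close>

theorem theorem4p1:
  fixes S1 :: "(real^'n::finite^'m::{finite,linorder}) set"
    and S2 :: "(real^'m::{finite,linorder}) set"
    and \<Phi>1 :: "real^'k1::finite^('n \<times> 'm)"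
    and \<Phi>2 :: "real^'k2::finite^'m::{finite,linorder}"
    and A :: "real^'n^'m::{finite,linorder}" and b :: "real^'m::{finite,linorder}"
    and L :: "real^'k::finite^'n"
    and J :: "real^'m::{finite,linorder}^'m::{finite,linorder}" and M :: "real^'n^'n"
    and x :: "real^'n" and r :: "real^'m::{finite,linorder}"
    and N :: "real^('n \<times> 'm)^'k" and K :: "real^'m::{finite,linorder}^'k"
    and Mg :: "real^(('n \<times> 'm) + 'm)^'k"
    and D1 :: "real^'k1^'k1" and D2 :: "real^'k2^'k2"
    and p q :: nat
  assumes "CARD('n) \<le> CARD('m)" and "CARD('k) \<le> CARD('n)"
    and "subspace S1" and "subspace S2"
    and "structure_matrix \<Phi>1" and "structure_matrix \<Phi>2"
    and "\<forall>X. X \<in> S1 \<longleftrightarrow> (\<exists>s. vec_of X = \<Phi>1 *v s)"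
    and "\<forall>y. y \<in> S2 \<longleftrightarrow> (\<exists>s. y = \<Phi>2 *v s)"
    and "A \<in> S1" and "b \<in> S2"
    and "p + q = CARD('m)" and "J = signature_mat p"
    and "M = transpose A ** J ** A" and "pos_def M"
    and "x = matrix_inv M *v (transpose A *v (J *v b))" and "r = b - A *v x"
    and "K = transpose L ** matrix_inv M ** transpose A ** J"
    and "N = row_kron (J *v r) (transpose L ** matrix_inv M) ** vec_perm - row_kron x K"
    and "Mg = hcat N K"
    and "D1 = col_norms \<Phi>1" and "D2 = col_norms \<Phi>2"
  shows
    "(\<forall>\<Psi>\<in>S1. \<forall>\<beta>\<in>S2. \<forall>\<xi> :: real^'k.
        kappa_2ILS S1 S2 J L \<Psi> \<beta> \<xi> A b =
        ennreal (spectral_norm (diag_ddag \<xi> ** Mg ** diag_mat (vec_pair \<Psi> \<beta>)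
          ** block_diag (\<Phi>1 ** matrix_inv D1) (\<Phi>2 ** matrix_inv D2)))) \<and>
     (\<forall>\<psi> \<beta> \<xi> :: real. \<psi> > 0 \<longrightarrow> \<beta> > 0 \<longrightarrow> \<xi> > 0 \<longrightarrow>
        kappa_2ILS_scalar S1 S2 J L \<psi> \<beta> \<xi> A b =
        ennreal (spectral_norm (hcat (\<psi> *\<^sub>R (N ** \<Phi>1 ** matrix_inv D1))
          (\<beta> *\<^sub>R (K ** \<Phi>2 ** matrix_inv D2))) / \<xi>))"
proof -
  have \<Phi>1: "structure_matrix \<Phi>1" and \<Phi>2: "structure_matrix \<Phi>2"
    and inv: "invertible M"
    using assms pos_def_invertible by blast+
  have S1: "X \<in> S1 \<longleftrightarrow> (\<exists>s. vec_of X = \<Phi>1 *v s)" and S2: "y \<in> S2 \<longleftrightarrow> (\<exists>s. y = \<Phi>2 *v s)" for X y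
    using assms by blast+
  let ?C1 = "normalize_columns \<Phi>1" and ?C2 = "normalize_columns \<Phi>2"
  have C: "\<Phi>1 ** matrix_inv D1 = ?C1" "\<Phi>2 ** matrix_inv D2 = ?C2"
    using assms by (simp_all add: normalize_columns_def)
  have Mg: "Mg *v vec_append v w = N *v v + K *v w" for v w
    using assms by (simp add: hcat_mult_vec_append)

  have deriv: "frechet_derivative (ils_g J L) (at (A, b)) (dA, db) = Mg *v vec_pair dA db" for dA db
  proof -
    have x: "x = ils_solution J A b"
      using assms by (simp add: ils_solution_def)
    have "((\<lambda>z. transpose L *v (case z of (A, b) \<Rightarrow> ils_solution J A b)) has_derivative
        (\<lambda>z. transpose L *v (case z of (dA, db) \<Rightarrow> matrix_inv M *v (transpose dA *v (J *v r)
          - transpose A *v (J *v (dA *v x)) + transpose A *v (J *v db))))) (at (A, b))"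
      using ils_solution_has_derivative[of A J b] inv assms(13,16) x
      by (intro bounded_linear.has_derivative[OF matrix_vector_mul_bounded_linear]) simp
    moreover have "(\<lambda>z. transpose L *v (case z of (A, b) \<Rightarrow> ils_solution J A b)) = ils_g J L"
      by (auto simp: ils_g_def)
    ultimately have "frechet_derivative (ils_g J L) (at (A, b)) (dA, db)
        = transpose L *v (matrix_inv M *v (transpose dA *v (J *v r)
          - transpose A *v (J *v (dA *v x)) + transpose A *v (J *v db)))"
      by (metis (no_types, lifting) frechet_derivative_at old.prod.case)
    also have "\<dots> = (transpose L ** matrix_inv M) *v (transpose dA *v (J *v r))
        - K *v (dA *v x) + K *v db"
      using assms(17)
      by (simp add: algebra_simps matrix_vector_mul_assoc[symmetric])
    \<comment> \<open>\<open>vec_perm\<close> turns the stacked \<open>dA\<close> into its stacked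
      transpose, so the first Kronecker block produces the term with \<open>J *v r\<close> and the
      second the term with \<open>x\<close>.\<close>
    also have "\<dots> = Mg *v vec_pair dA db"
      using assms(18)
      by (simp add: vec_pair_def Mg matrix_vector_mult_diff_rdistrib row_kron_mult_vec_of
          vec_perm_mult_vec_of matrix_vector_mul_assoc[of _ vec_perm, symmetric])
    finally show ?thesis .
  qed

  show ?thesis
  proof (intro conjI ballI allI impI)
    fix \<Psi> \<beta> and \<xi> :: "real^'k"
    assume "\<Psi> \<in> S1" "\<beta> \<in> S2"
    then obtain \<phi>1 \<phi>2 where \<phi>1: "vec_of \<Psi> = \<Phi>1 *v \<phi>1" and \<phi>2: "\<beta> = \<Phi>2 *v \<phi>2"
      using S1 S2 by blast
    define B where "B = diag_ddag \<xi> ** Mg ** diag_mat (vec_pair \<Psi> \<beta>) ** block_diag ?C1 ?C2"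
    define P where "P = {(dA, db). dA \<in> S1 \<and> db \<in> S2 \<and>
      norm (vec_pair (mat_div dA \<Psi>) (vec_div db \<beta>)) \<noteq> 0 \<and>
      (\<forall>i j. \<Psi> $ i $ j = 0 \<longrightarrow> dA $ i $ j = 0) \<and> (\<forall>i. \<beta> $ i = 0 \<longrightarrow> db $ i = 0)}"
    define f where "f = (\<lambda>(dA, db).
      norm (vec_div (frechet_derivative (ils_g J L) (at (A, b)) (dA, db)) \<xi>)
        / norm (vec_pair (mat_div dA \<Psi>) (vec_div db \<beta>)))"
    \<comment> \<open>\<open>B\<close> first forms the perturbation parametrised by
      \<open>u1\<close> and \<open>u2\<close>, then applies the derivative and divides by \<xi>, so
      it reproduces the numerator of the quotient.\<close>
    have B: "B *v vec_append u1 u2 = vec_div (Mg *v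
        vec_append (diag_mat (vec_of \<Psi>) *v (?C1 *v u1)) (diag_mat \<beta> *v (?C2 *v u2))) \<xi>" for u1 u2
      by (simp add: B_def vec_div_def vec_pair_def block_diag_mult_vec_append
          diag_mat_vec_append_mult flip: matrix_vector_mul_assoc)
    have f: "f (dA, db) = norm (vec_div (Mg *v vec_append (vec_of dA) db) \<xi>)
        / norm (vec_append (vec_div (vec_of dA) (vec_of \<Psi>)) (vec_div db \<beta>))" for dA db
      by (simp add: f_def deriv vec_pair_def vec_of_mat_div)
    have "(SUP p\<in>P. ennreal (f p)) = ennreal (spectral_norm B)"
    proof (rule SUP_eq_spectral_norm)
      fix p
      assume "p \<in> P"
      then obtain dA db where p: "p = (dA, db)" and dA: "dA \<in> S1" and db: "db \<in> S2"
        and zero: "\<And>i j. \<Psi> $ i $ j = 0 \<Longrightarrow> dA $ i $ j = 0" "\<And>i. \<beta> $ i = 0 \<Longrightarrow> db $ i = 0"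
        by (auto simp: P_def)
      obtain s1 s2 where s: "vec_of dA = \<Phi>1 *v s1" "db = \<Phi>2 *v s2"
        using dA db S1 S2 by blast
      obtain u1 where u1: "vec_of dA = diag_mat (vec_of \<Psi>) *v (?C1 *v u1)"
        "norm (vec_div (vec_of dA) (vec_of \<Psi>)) = norm u1"
        using admissible_as_scaled_parameter[OF \<Phi>1 s(1) \<phi>1] zero(1)
        by (auto simp: vec_of_def)
      obtain u2 where u2: "db = diag_mat \<beta> *v (?C2 *v u2)" "norm (vec_div db \<beta>) = norm u2"
        using admissible_as_scaled_parameter[OF \<Phi>2 s(2) \<phi>2 zero(2)] by blast
      show "\<exists>u. f p = norm (B *v u) / norm u"
        by (rule exI[of _ "vec_append u1 u2"])
          (simp add: p f B norm_vec_append u1(2) u2(2) flip: u1(1) u2(1))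
    next
      fix u
      assume nz: "B *v u \<noteq> 0"
      obtain u1 u2 where u: "u = vec_append u1 u2"
        using vec_append_surj by blast
      obtain s1 where s1: "\<Phi>1 *v s1 = diag_mat (vec_of \<Psi>) *v (?C1 *v u1)"
        "norm (vec_div (\<Phi>1 *v s1) (vec_of \<Psi>)) \<le> norm u1"
        using scaled_parameter_as_admissible[OF \<Phi>1 \<phi>1] by blast
      obtain s2 where s2: "\<Phi>2 *v s2 = diag_mat \<beta> *v (?C2 *v u2)"
        "norm (vec_div (\<Phi>2 *v s2) \<beta>) \<le> norm u2"
        using scaled_parameter_as_admissible[OF \<Phi>2 \<phi>2] by blast
      obtain dA where dA: "vec_of dA = \<Phi>1 *v s1"
        using vec_of_surj by blast
      define db where "db = \<Phi>2 *v s2"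
      define d where "d = vec_append (vec_div (vec_of dA) (vec_of \<Psi>)) (vec_div db \<beta>)"
      have Bu: "B *v u = vec_div (Mg *v vec_append (vec_of dA) db) \<xi>"
        by (simp add: u B dA db_def s1(1) s2(1))
      \<comment> \<open>A nonzero derivative needs a nonzero perturbation, and division by the
        parameters cannot annihilate it because \<open>ddag\<close> is never 0. So the denominator
        is nonzero and the pair is admissible.\<close>
      then have "vec_append (vec_of dA) db \<noteq> 0"
        using nz by (auto simp: vec_div_eq_0_iff)
      then have d: "norm d \<noteq> 0"
        by (simp add: d_def vec_append_eq_0_iff vec_div_eq_0_iff)
      have "dA $ i $ j = 0" if "\<Psi> $ i $ j = 0" for i j
        using that by (metis dA diag_mat_mult_nth mult_zero_left s1(1) vec_of_nth)
      moreover have "db $ i = 0" if "\<beta> $ i = 0" for i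
        using that by (simp add: db_def s2(1) diag_mat_mult_nth)
      ultimately have "(dA, db) \<in> P"
        using d dA S1 S2 by (auto simp: P_def vec_pair_def vec_of_mat_div d_def db_def)
      \<comment> \<open>Both quotients have the same numerator, so the smaller denominator
        \<open>norm d\<close> can only increase the value.\<close>
      moreover have "norm d \<le> norm u"
        using s1(2) s2(2)
        by (simp add: d_def u norm_vec_append dA db_def add_mono power_mono)
      then have "norm (B *v u) / norm u \<le> f (dA, db)"
        using d order_trans[of 0 "norm d" "norm u"]
        by (simp add: f Bu frac_le flip: d_def)
      ultimately show "\<exists>p\<in>P. norm (B *v u) / norm u \<le> f p"
        by blast
    qed
    then show "kappa_2ILS S1 S2 J L \<Psi> \<beta> \<xi> A b =
      ennreal (spectral_norm (diag_ddag \<xi> ** Mg ** diag_mat (vec_pair \<Psi> \<beta>)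
        ** block_diag (\<Phi>1 ** matrix_inv D1) (\<Phi>2 ** matrix_inv D2)))"
      unfolding kappa_2ILS_def C B_def P_def f_def by (simp only: case_prod_unfold prod.collapse)
  next
    fix \<psi> \<beta> \<xi> :: real
    assume pos: "\<psi> > 0" "\<beta> > 0" "\<xi> > 0"
    define H where "H = hcat (\<psi> *\<^sub>R (N ** ?C1)) (\<beta> *\<^sub>R (K ** ?C2))"
    \<comment> \<open>The factor 1/\<xi> is absorbed into the matrix for the supremum argument and
      pulled out of the operator norm at the end.\<close>
    define B where "B = (1 / \<xi>) *\<^sub>R H"
    define P where "P = {(dA, db). dA \<in> S1 \<and> db \<in> S2 \<and>
      norm (vec_pair (dA /\<^sub>R \<psi>) (db /\<^sub>R \<beta>)) \<noteq> 0}"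
    define f where "f = (\<lambda>(dA, db).
      norm (frechet_derivative (ils_g J L) (at (A, b)) (dA, db) /\<^sub>R \<xi>)
        / norm (vec_pair (dA /\<^sub>R \<psi>) (db /\<^sub>R \<beta>)))"
    have B: "B *v vec_append u1 u2
        = (Mg *v vec_append (\<psi> *\<^sub>R (?C1 *v u1)) (\<beta> *\<^sub>R (?C2 *v u2))) /\<^sub>R \<xi>" for u1 u2
      by (simp add: B_def H_def Mg hcat_mult_vec_append matrix_vector_mult_scaleR inverse_eq_divide
          flip: matrix_vector_mul_assoc scaleR_matrix_vector_assoc)
    have f: "f (dA, db) = norm ((Mg *v vec_append (vec_of dA) db) /\<^sub>R \<xi>)
        / norm (vec_append (vec_of dA /\<^sub>R \<psi>) (db /\<^sub>R \<beta>))" for dA db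
      by (simp add: f_def deriv vec_pair_def vec_of_scaleR)
    have "(SUP p\<in>P. ennreal (f p)) = ennreal (spectral_norm B)"
    proof (rule SUP_eq_spectral_norm)
      fix p
      assume "p \<in> P"
      then obtain dA db where p: "p = (dA, db)" and dA: "dA \<in> S1" and db: "db \<in> S2"
        by (auto simp: P_def)
      obtain s1 s2 where s: "vec_of dA = \<Phi>1 *v s1" "db = \<Phi>2 *v s2"
        using dA db S1 S2 by blast
      \<comment> \<open>The coefficients are chosen so that the normalised structure matrices send
        them to the scaled perturbations; being isometries, they preserve the denominator.\<close>
      define u1 where "u1 = (col_norms \<Phi>1 *v s1) /\<^sub>R \<psi>"
      define u2 where "u2 = (col_norms \<Phi>2 *v s2) /\<^sub>R \<beta>"
      have u: "?C1 *v u1 = vec_of dA /\<^sub>R \<psi>" "?C2 *v u2 = db /\<^sub>R \<beta>"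
        by (simp_all add: u1_def u2_def matrix_vector_mult_scaleR s
            normalize_columns_mult_col_norms \<Phi>1 \<Phi>2)
      have "norm (vec_append u1 u2) = norm (vec_append (vec_of dA /\<^sub>R \<psi>) (db /\<^sub>R \<beta>))"
        using norm_normalize_columns_mult[OF \<Phi>1, of u1] norm_normalize_columns_mult[OF \<Phi>2, of u2]
        by (simp only: norm_vec_append u)
      then show "\<exists>u. f p = norm (B *v u) / norm u"
        using pos by (intro exI[of _ "vec_append u1 u2"]) (simp add: p f B u)
    next
      fix u
      assume nz: "B *v u \<noteq> 0"
      obtain u1 u2 where u: "u = vec_append u1 u2"
        using vec_append_surj by blast
      obtain dA where dA: "vec_of dA = \<psi> *\<^sub>R (?C1 *v u1)"
        using vec_of_surj by blast
      define db where "db = \<beta> *\<^sub>R (?C2 *v u2)"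
      have mem: "dA \<in> S1" "db \<in> S2"
        unfolding S1 S2 dA db_def normalize_columns_def
        by (metis matrix_vector_mul_assoc matrix_vector_mult_scaleR)+
      \<comment> \<open>A positive scalar loses no coordinates, so the denominator equals
        \<open>norm u\<close> here instead of being only bounded by it.\<close>
      have n: "norm (vec_append (vec_of dA /\<^sub>R \<psi>) (db /\<^sub>R \<beta>)) = norm u"
        using pos by (simp add: dA db_def u norm_vec_append norm_normalize_columns_mult \<Phi>1 \<Phi>2)
      moreover have "norm u \<noteq> 0"
        using nz by auto
      ultimately have "(dA, db) \<in> P"
        using mem by (simp add: P_def vec_pair_def vec_of_scaleR del: norm_eq_zero)
      moreover have "f (dA, db) = norm (B *v u) / norm u"
        unfolding f n by (simp add: u B dA db_def)
      ultimately show "\<exists>p\<in>P. norm (B *v u) / norm u \<le> f p"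
        by force
    qed
    moreover have "spectral_norm B = spectral_norm H / \<xi>"
      using pos onorm_scaleR[OF matrix_vector_mul_bounded_linear, of "1 / \<xi>" H]
      by (simp add: spectral_norm_def B_def scaleR_matrix_vector_assoc)
    ultimately show "kappa_2ILS_scalar S1 S2 J L \<psi> \<beta> \<xi> A b =
      ennreal (spectral_norm (hcat (\<psi> *\<^sub>R (N ** \<Phi>1 ** matrix_inv D1))
        (\<beta> *\<^sub>R (K ** \<Phi>2 ** matrix_inv D2))) / \<xi>)"
      unfolding kappa_2ILS_scalar_def H_def P_def f_def matrix_mul_assoc[symmetric] C
      by (simp only: case_prod_unfold prod.collapse)
  qed
qed

end
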